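(* Let $G$ be a finite abelian group of order $n$ such that the generalized dihedral group $D(G)$ is non-abelian, let $r\ge0$ satisfy $2^r=|\{g\in G:g^2=e\}|$, and let $\Gamma=\mathfrak{C}(D(G),D(G))$. Then the metric dimension of $\Gamma$ is \[\beta(\Gamma)=\begin{cases}2n-\frac{n}{2^r}-2 & \text{if } 2^r\ge 2,\\ 2n-3 & \text{if } 2^r=1.\end{cases}\]
   Context: $D(G)=G\rtimes C_2$, $C_2=\{1,-1\}$, has elements $(g,c)$ with multiplication $(g_1,c_1)(g_2,c_2)=(g_1g_2^{c_1},c_1c_2)$; its center is $\{(g,1):g^2=e\}$, of size $2^r$. The commuting graph $\mathfrak{C}(D(G),D(G))$ is the simple graph with vertex set $D(G)$ in which distinct $u,v$ are adjacent iff $uv=vu$. A set $W=\{w_1,\dots,w_k\}$ of vertices of a connected graph is resolving if every vertex $v$ is uniquely determined by the vector $(d(v,w_1),\dots,d(v,w_k))$ of shortest-path distances; the metric dimension $\beta(\Gamma)$ is the minimum size of a resolving set. *)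

theory Defs
  imports "HOL-Algebra.Coset" "Graph_Theory.Graph_Theory"
begin

text \<open>The group \<open>C\<^sub>2\<close> is the set of integers \<open>{1, -1}\<close> under multiplication, acting on \<open>G\<close> by
  integer powers.\<close>

definition gen_dihedral :: "('a, 'b) monoid_scheme \<Rightarrow> ('a \<times> int) monoid" where
  "gen_dihedral G = \<lparr>
     carrier = carrier G \<times> {1, -1},
     monoid.mult = (\<lambda>(g1, c1) (g2, c2). (g1 \<otimes>\<^bsub>G\<^esub> g2 [^]\<^bsub>G\<^esub> c1, c1 * c2)),
     one = (\<one>\<^bsub>G\<^esub>, 1)\<rparr>"

text \<open>The simple graph on \<open>X\<close> is encoded as a symmetric, loop-free digraph: each edge is
  represented by its two orientations.\<close>

definition commuting_graph :: "('a, 'b) monoid_scheme \<Rightarrow> 'a set \<Rightarrow> 'a pair_pre_digraph" where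
  "commuting_graph H X = \<lparr>
     pverts = X,
     parcs = {(u, v). u \<in> X \<and> v \<in> X \<and> u \<noteq> v \<and> u \<otimes>\<^bsub>H\<^esub> v = v \<otimes>\<^bsub>H\<^esub> u}\<rparr>"

text \<open>With unit weights, the cost of a walk is its number of edges, so \<^term>\<open>wf_digraph.\<mu>\<close>
  is the shortest-path distance (and infinite between different components).\<close>

definition graph_dist :: "('a, 'b) pre_digraph \<Rightarrow> 'a \<Rightarrow> 'a \<Rightarrow> ereal" where
  "graph_dist \<Gamma> u v = wf_digraph.\<mu> \<Gamma> (\<lambda>_. 1) u v"

definition resolving_set :: "('a, 'b) pre_digraph \<Rightarrow> 'a set \<Rightarrow> bool" where
  "resolving_set \<Gamma> W \<longleftrightarrow> finite W \<and> W \<subseteq> verts \<Gamma> \<and>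
     (\<forall>u \<in> verts \<Gamma>. \<forall>v \<in> verts \<Gamma>.
        (\<forall>w \<in> W. graph_dist \<Gamma> u w = graph_dist \<Gamma> v w) \<longrightarrow> u = v)"

definition metric_dimension :: "('a, 'b) pre_digraph \<Rightarrow> nat" where
  "metric_dimension \<Gamma> = (LEAST k. \<exists>W. resolving_set \<Gamma> W \<and> card W = k)"

text \<open>The remaining lemmas show that the generalized dihedral group is a group, and that commuting
  graphs of finite groups are finite, simple and connected.\<close>

lemma (in comm_group) group_gen_dihedral: "group (gen_dihedral G)"
proof (rule groupI)
  fix x y assume "x \<in> carrier (gen_dihedral G)" "y \<in> carrier (gen_dihedral G)"
  then show "x \<otimes>\<^bsub>gen_dihedral G\<^esub> y \<in> carrier (gen_dihedral G)"
    by (auto simp: gen_dihedral_def)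
next
  show "\<one>\<^bsub>gen_dihedral G\<^esub> \<in> carrier (gen_dihedral G)"
    by (simp add: gen_dihedral_def)
next
  fix x y z
  assume "x \<in> carrier (gen_dihedral G)" "y \<in> carrier (gen_dihedral G)"
    "z \<in> carrier (gen_dihedral G)"
  then show "x \<otimes>\<^bsub>gen_dihedral G\<^esub> y \<otimes>\<^bsub>gen_dihedral G\<^esub> z =
      x \<otimes>\<^bsub>gen_dihedral G\<^esub> (y \<otimes>\<^bsub>gen_dihedral G\<^esub> z)"
    by (auto simp: gen_dihedral_def int_pow_neg int_pow_distrib inv_mult m_assoc)
next
  fix x assume "x \<in> carrier (gen_dihedral G)"
  then show "\<one>\<^bsub>gen_dihedral G\<^esub> \<otimes>\<^bsub>gen_dihedral G\<^esub> x = x"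
    by (auto simp: gen_dihedral_def)
next
  fix x assume x: "x \<in> carrier (gen_dihedral G)"
  then obtain g c where gc: "x = (g, c)" "g \<in> carrier G" "c = 1 \<or> c = -1"
    by (auto simp: gen_dihedral_def)
  show "\<exists>y\<in>carrier (gen_dihedral G). y \<otimes>\<^bsub>gen_dihedral G\<^esub> x = \<one>\<^bsub>gen_dihedral G\<^esub>"
    using gc
    by (intro bexI[of _ "(if c = 1 then inv g else g, c)"])
      (auto simp: gen_dihedral_def int_pow_neg)
qed

lemma pair_graph_commuting_graph:
  assumes "finite X"
  shows "pair_graph (commuting_graph H X)"
proof
  show "finite (parcs (commuting_graph H X))"
    by (rule finite_subset[of _ "X \<times> X"]) (auto simp: commuting_graph_def assms)
  show "symmetric (commuting_graph H X)"
    by (auto simp: symmetric_def commuting_graph_def intro: symI)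
qed (auto simp: commuting_graph_def assms)

lemma connected_commuting_graph:
  assumes "group H" "finite (carrier H)"
  shows "connected (commuting_graph H (carrier H))"
proof -
  interpret H: group H by fact
  interpret \<Gamma>: pair_graph "commuting_graph H (carrier H)"
    using assms(2) by (rule pair_graph_commuting_graph)
  have adj: "(u, \<one>\<^bsub>H\<^esub>) \<in> parcs (commuting_graph H (carrier H))"
      "(\<one>\<^bsub>H\<^esub>, u) \<in> parcs (commuting_graph H (carrier H))"
    if "u \<in> carrier H" "u \<noteq> \<one>\<^bsub>H\<^esub>" for u
    using that by (auto simp: commuting_graph_def)
  have refl: "\<one>\<^bsub>H\<^esub> \<rightarrow>\<^sup>*\<^bsub>commuting_graph H (carrier H)\<^esub> \<one>\<^bsub>H\<^esub>"
    by (rule \<Gamma>.reachable_refl) (simp add: commuting_graph_def)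
  have reach: "u \<rightarrow>\<^sup>*\<^bsub>commuting_graph H (carrier H)\<^esub> \<one>\<^bsub>H\<^esub>"
      "\<one>\<^bsub>H\<^esub> \<rightarrow>\<^sup>*\<^bsub>commuting_graph H (carrier H)\<^esub> u"
    if "u \<in> carrier H" for u
    using adj[OF that] refl \<Gamma>.reachable_adjI by metis+
  show ?thesis
  proof (rule \<Gamma>.connectedI)
    show "pverts (commuting_graph H (carrier H)) \<noteq> {}"
      using H.one_closed by (auto simp: commuting_graph_def)
  next
    fix u v
    assume "u \<in> pverts (commuting_graph H (carrier H))" "v \<in> pverts (commuting_graph H (carrier H))"
    then have "u \<in> carrier H" "v \<in> carrier H"
      by (simp_all add: commuting_graph_def)
    then have "u \<rightarrow>\<^sup>*\<^bsub>commuting_graph H (carrier H)\<^esub> v"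
      using \<Gamma>.reachable_trans[OF reach(1) reach(2)] by blast
    then show "u \<rightarrow>\<^sup>*\<^bsub>mk_symmetric (commuting_graph H (carrier H))\<^esub> v"
      using \<Gamma>.reachable_mk_symmetric_eq[OF \<Gamma>.pair_sym_arcs] by simp
  qed
qed

end

theory Submission
  imports Defs
begin

text \<open>The identity is adjacent to every other vertex of a commuting graph, so all distances are at
  most 2. Vertices with the same closed neighbourhood (or the same open one) are twins, and a
  resolving set contains all but at most one vertex of each class of twins. Let \<open>T\<close> be the set of
  all \<open>g\<close> with \<open>g\<^sup>2 = e\<close>. The twin classes of the commuting graph of \<open>D(G)\<close> are the
  centre \<open>T \<times> {1}\<close>, the set \<open>(G - T) \<times> {1}\<close>, and among the reflections the sets
  \<open>T g \<times> {-1}\<close> if \<open>T\<close> is non-trivial, but the single class \<open>G \<times> {-1}\<close> if \<open>T\<close> is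
  trivial. Conversely, omitting exactly one vertex of each class leaves a resolving set, because any
  two classes are told apart by two different members of one class. Hence the metric dimension is
  \<open>2 n\<close> minus the number of classes.\<close>

section \<open>Distances in a commuting graph\<close>

lemma graph_dist_commuting_graph:
  assumes "monoid H" and u: "u \<in> carrier H" and v: "v \<in> carrier H"
  shows "graph_dist (with_proj (commuting_graph H (carrier H))) u v =
    (if u = v then 0 else if u \<otimes>\<^bsub>H\<^esub> v = v \<otimes>\<^bsub>H\<^esub> u then 1 else 2)"
proof -
  interpret H: monoid H by fact
  let ?\<Gamma> = "commuting_graph H (carrier H)"
  interpret pair_wf_digraph ?\<Gamma>
    by unfold_locales (auto simp: commuting_graph_def)
  have V: "pverts ?\<Gamma> = carrier H"
    and A: "parcs ?\<Gamma> =
      {(x, y). x \<in> carrier H \<and> y \<in> carrier H \<and> x \<noteq> y \<and> x \<otimes>\<^bsub>H\<^esub> y = y \<otimes>\<^bsub>H\<^esub> x}"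
    by (simp_all add: commuting_graph_def)
  have cost: "awalk_cost (\<lambda>_. 1) p = real (length p)" for p :: "('a \<times> 'a) list"
    by (induction p) auto
  \<comment> \<open>\<open>\<mu>\<close> is an infimum over all walks, which a walk of least length
    attains; each case below needs only one walk and a lower bound on lengths.\<close>
  have eq: "graph_dist (with_proj ?\<Gamma>) u v = real (length p)"
    if "awalk u p v" "\<And>q. awalk u q v \<Longrightarrow> length p \<le> length q" for p
    unfolding graph_dist_def \<mu>_def cost
    by (rule antisym) (use that in \<open>auto intro: INF_lower2 INF_greatest\<close>)
  consider "u = v" | "u \<noteq> v" "u \<otimes>\<^bsub>H\<^esub> v = v \<otimes>\<^bsub>H\<^esub> u" | "u \<otimes>\<^bsub>H\<^esub> v \<noteq> v \<otimes>\<^bsub>H\<^esub> u"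
    by blast
  then show ?thesis
  proof cases
    case 1
    then have "awalk u [] v"
      using u by (simp add: awalk_Nil_iff V)
    from eq[OF this] show ?thesis
      using 1 by simp
  next
    case 2
    then have w: "awalk u [(u, v)] v"
      using u v by (simp add: awalk_simps V A)
    have "1 \<le> length q" if "awalk u q v" for q
      using that 2 by (cases q) (auto simp: awalk_simps)
    with eq[OF w] show ?thesis
      using 2 by simp
  next
    case 3
    then have ne: "u \<noteq> v" "u \<noteq> \<one>\<^bsub>H\<^esub>" "v \<noteq> \<one>\<^bsub>H\<^esub>"
      using u v by auto
    then have w: "awalk u [(u, \<one>\<^bsub>H\<^esub>), (\<one>\<^bsub>H\<^esub>, v)] v"
      using u v by (simp add: awalk_simps V A)
    have "length [(u, \<one>\<^bsub>H\<^esub>), (\<one>\<^bsub>H\<^esub>, v)] \<le> length q" if "awalk u q v" for q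
    proof (rule ccontr)
      assume "\<not> length [(u, \<one>\<^bsub>H\<^esub>), (\<one>\<^bsub>H\<^esub>, v)] \<le> length q"
      then consider "q = []" | e where "q = [e]"
        by (cases q; cases "tl q") auto
      then show False
        using that 3 by cases (auto simp: awalk_simps A)
    qed
    from eq[OF w this] show ?thesis
      using 3 ne by simp
  qed
qed

section \<open>Metric dimension from a partition into twin classes\<close>

text \<open>The labelling \<open>f\<close> names the classes. The separation hypothesis asks for two
  witnesses in one class because a set omitting a single vertex per class still contains one of
  them.\<close>

lemma metric_dimension_twin_classes:
  assumes fin: "finite (verts \<Gamma>)"
    and refl: "\<And>u v. u \<in> verts \<Gamma> \<Longrightarrow> v \<in> verts \<Gamma> \<Longrightarrow> graph_dist \<Gamma> u v = 0 \<longleftrightarrow> u = v"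
    and twin: "\<And>u v w. u \<in> verts \<Gamma> \<Longrightarrow> v \<in> verts \<Gamma> \<Longrightarrow> w \<in> verts \<Gamma> \<Longrightarrow> f u = f v \<Longrightarrow>
      w \<noteq> u \<Longrightarrow> w \<noteq> v \<Longrightarrow> graph_dist \<Gamma> u w = graph_dist \<Gamma> v w"
    and sep: "\<And>u v. u \<in> verts \<Gamma> \<Longrightarrow> v \<in> verts \<Gamma> \<Longrightarrow> f u \<noteq> f v \<Longrightarrow>
      \<exists>w\<in>verts \<Gamma>. \<exists>w'\<in>verts \<Gamma>. w \<noteq> w' \<and> f w = f w' \<and>
        graph_dist \<Gamma> u w \<noteq> graph_dist \<Gamma> v w \<and> graph_dist \<Gamma> u w' \<noteq> graph_dist \<Gamma> v w'"
  shows "metric_dimension \<Gamma> + card (f ` verts \<Gamma>) = card (verts \<Gamma>)"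
proof -
  let ?V = "verts \<Gamma>"
  have lower: "card ?V \<le> card W + card (f ` ?V)" if W: "resolving_set \<Gamma> W" for W
  proof -
    have sub: "W \<subseteq> ?V" "finite W"
      using W by (auto simp: resolving_set_def)
    \<comment> \<open>Omitted vertices differ from every landmark, so two omitted twins could not be
      told apart.\<close>
    have "inj_on f (?V - W)"
    proof (rule inj_onI)
      fix u v assume uv: "u \<in> ?V - W" "v \<in> ?V - W" "f u = f v"
      then have "\<forall>w\<in>W. graph_dist \<Gamma> u w = graph_dist \<Gamma> v w"
        using sub twin by blast
      then show "u = v"
        using W uv by (auto simp: resolving_set_def)
    qed
    then have "card (?V - W) \<le> card (f ` ?V)"
      by (rule card_inj_on_le) (use fin in auto)
    moreover have "card (?V - W) + card W = card ?V"
      using sub fin by (metis card_Diff_subset card_mono le_add_diff_inverse2)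
    ultimately show ?thesis
      by linarith
  qed
  obtain R where R: "R \<subseteq> ?V" "inj_on f R" "f ` R = f ` ?V"
    using iffD1[OF subset_image_inj order_refl, of ?V f] by metis
  have "resolving_set \<Gamma> (?V - R)"
    unfolding resolving_set_def
  proof (intro conjI ballI impI)
    fix u v
    assume u: "u \<in> ?V" and v: "v \<in> ?V"
      and eq: "\<forall>w\<in>?V - R. graph_dist \<Gamma> u w = graph_dist \<Gamma> v w"
    show "u = v"
    proof (rule ccontr)
      assume "u \<noteq> v"
      \<comment> \<open>A landmark is the only vertex at distance 0 from itself, so neither vertex
        can be one.\<close>
      then have "u \<in> R" "v \<in> R"
        using eq refl u v by (metis DiffI)+
      then have "f u \<noteq> f v"
        using R(2) \<open>u \<noteq> v\<close> by (auto dest: inj_onD)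
      from sep[OF u v this] obtain w w' where
        w: "w \<in> ?V" "w' \<in> ?V" "w \<noteq> w'" "f w = f w'"
          "graph_dist \<Gamma> u w \<noteq> graph_dist \<Gamma> v w" "graph_dist \<Gamma> u w' \<noteq> graph_dist \<Gamma> v w'"
        by blast
      then have "w \<in> R" "w' \<in> R"
        using eq by blast+
      then show False
        using R(2) w(3,4) by (auto dest: inj_onD)
    qed
  qed (use fin in auto)
  moreover have "card (?V - R) + card (f ` ?V) = card ?V"
    using R fin by (metis card_Diff_subset card_image card_mono finite_subset le_add_diff_inverse2)
  ultimately have "metric_dimension \<Gamma> = card (?V - R)"
    unfolding metric_dimension_def
    by (intro Least_equality) (use lower in fastforce)+
  then show ?thesis
    using \<open>card (?V - R) + card (f ` ?V) = card ?V\<close> by simp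
qed

section \<open>The 2-torsion subgroup and commutation in \<open>gen_dihedral G\<close>\<close>

definition two_torsion :: "('a, 'b) monoid_scheme \<Rightarrow> 'a set" where
  "two_torsion G = {g \<in> carrier G. g [^]\<^bsub>G\<^esub> (2::nat) = \<one>\<^bsub>G\<^esub>}"

context comm_group
begin

lemma two_torsion_iff: "g \<in> two_torsion G \<longleftrightarrow> g \<in> carrier G \<and> g = inv g"
  by (auto simp: two_torsion_def numeral_2_eq_2 intro: inv_equality[symmetric])
    (metis r_inv)

lemma subgroup_two_torsion: "subgroup (two_torsion G) G"
proof (rule subgroupI)
  show "two_torsion G \<noteq> {}"
    using one_closed inv_one by (metis empty_iff two_torsion_iff)
qed (auto simp: two_torsion_iff inv_mult)

lemma carrier_gen_dihedral: "carrier (gen_dihedral G) = carrier G \<times> {1, -1}"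
  by (simp add: gen_dihedral_def)

lemma commute_rotations:
  assumes "g \<in> carrier G" "h \<in> carrier G"
  shows "(g, 1) \<otimes>\<^bsub>gen_dihedral G\<^esub> (h, 1) = (h, 1) \<otimes>\<^bsub>gen_dihedral G\<^esub> (g, 1)"
  using assms by (simp add: gen_dihedral_def m_comm)

text \<open>Conjugation by a reflection inverts every rotation. Both orientations are recorded so
  that either order of the factors can be rewritten.\<close>

lemma commute_rotation_reflection:
  assumes "g \<in> carrier G" "h \<in> carrier G"
  shows "(g, 1) \<otimes>\<^bsub>gen_dihedral G\<^esub> (h, -1) = (h, -1) \<otimes>\<^bsub>gen_dihedral G\<^esub> (g, 1) \<longleftrightarrow>
      g \<in> two_torsion G"
    and "(h, -1) \<otimes>\<^bsub>gen_dihedral G\<^esub> (g, 1) = (g, 1) \<otimes>\<^bsub>gen_dihedral G\<^esub> (h, -1) \<longleftrightarrow>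
      g \<in> two_torsion G"
proof -
  have "g \<otimes> h = h \<otimes> inv g \<longleftrightarrow> g = inv g"
    using assms by (simp add: m_comm[of h])
  then show "(g, 1) \<otimes>\<^bsub>gen_dihedral G\<^esub> (h, -1) = (h, -1) \<otimes>\<^bsub>gen_dihedral G\<^esub> (g, 1) \<longleftrightarrow>
      g \<in> two_torsion G"
    "(h, -1) \<otimes>\<^bsub>gen_dihedral G\<^esub> (g, 1) = (g, 1) \<otimes>\<^bsub>gen_dihedral G\<^esub> (h, -1) \<longleftrightarrow>
      g \<in> two_torsion G"
    using assms by (auto simp: gen_dihedral_def two_torsion_iff int_pow_neg)
qed

lemma rcos_eq_iff:
  assumes "subgroup S G" "g \<in> carrier G" "h \<in> carrier G"
  shows "S #> g = S #> h \<longleftrightarrow> g \<otimes> inv h \<in> S"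
  using assms subgroup.rcos_module[OF assms(1) is_group]
  by (metis rcos_self repr_independence)

text \<open>The product of the two reflections is the rotation by \<open>g \<otimes> inv h\<close>,
  and swapping them inverts it; so they commute iff this element is 2-torsion.\<close>

lemma commute_reflections:
  assumes "g \<in> carrier G" "h \<in> carrier G"
  shows "(g, -1) \<otimes>\<^bsub>gen_dihedral G\<^esub> (h, -1) = (h, -1) \<otimes>\<^bsub>gen_dihedral G\<^esub> (g, -1) \<longleftrightarrow>
      two_torsion G #> g = two_torsion G #> h"
  using assms by (auto simp: gen_dihedral_def rcos_eq_iff[OF subgroup_two_torsion]
      two_torsion_iff int_pow_neg inv_mult m_comm)

text \<open>The fibres are the twin classes if \<open>S\<close> is the 2-torsion subgroup, or \<open>carrier G\<close> when the
  2-torsion is trivial.\<close>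

definition twin_class :: "'a set \<Rightarrow> 'a \<times> int \<Rightarrow> 'a set \<times> int" where
  "twin_class S = (\<lambda>(g, c).
     (if c = 1 then {h \<in> carrier G. h \<in> two_torsion G \<longleftrightarrow> g \<in> two_torsion G} else S #> g, c))"

section \<open>Counting and separating the twin classes\<close>

text \<open>Rotations form two classes, the 2-torsion and its complement, the latter inhabited by
  \<open>a\<close>; reflections form one class per coset of \<open>S\<close>.\<close>

lemma card_twin_classes:
  assumes fin: "finite (carrier G)" and S: "subgroup S G" and a: "a \<in> carrier G - two_torsion G"
  shows "card (twin_class S ` carrier (gen_dihedral G)) = 2 + card (rcosets S)"
proof -
  let ?T = "two_torsion G"
  have T: "?T \<subseteq> carrier G" "\<one> \<in> ?T"
    using subgroup.subset subgroup.one_closed subgroup_two_torsion by auto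
  have rot: "{h \<in> carrier G. h \<in> ?T \<longleftrightarrow> g \<in> ?T} = (if g \<in> ?T then ?T else carrier G - ?T)" for g
    using T by auto
  have "twin_class S ` carrier (gen_dihedral G) =
      {(?T, 1), (carrier G - ?T, 1)} \<union> (rcosets S) \<times> {-1}" (is "?L = ?R")
  proof
    have "twin_class S (g, c) \<in> ?R" if "g \<in> carrier G" "c = 1 \<or> c = -1" for g c
      using that(2)
    proof
      assume "c = 1"
      then show ?thesis
        unfolding twin_class_def rot by simp
    next
      assume "c = -1"
      then show ?thesis
        using rcosetsI[OF subgroup.subset[OF S] that(1)] by (simp add: twin_class_def)
    qed
    then show "?L \<subseteq> ?R"
      unfolding carrier_gen_dihedral by blast
    have "(?T, 1) = twin_class S (\<one>, 1)" "(carrier G - ?T, 1) = twin_class S (a, 1)"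
      using T a unfolding twin_class_def rot by simp_all
    moreover have "(S #> g, -1) \<in> ?L" if "g \<in> carrier G" for g
      by (rule image_eqI[of _ _ "(g, -1)"])
        (use that in \<open>simp_all add: twin_class_def carrier_gen_dihedral\<close>)
    then have "(rcosets S) \<times> {-1} \<subseteq> ?L"
      unfolding RCOSETS_def by blast
    moreover have "(\<one>, 1) \<in> carrier (gen_dihedral G)" "(a, 1) \<in> carrier (gen_dihedral G)"
      using a by (auto simp: carrier_gen_dihedral)
    ultimately show "?R \<subseteq> ?L"
      by blast
  qed
  moreover have "finite (rcosets S)"
    using fin S by (metis finite_Pow_iff finite_subset rcosets_subset_PowG)
  moreover have "?T \<noteq> carrier G - ?T"
    using T(2) by blast
  then have "card {(?T, 1::int), (carrier G - ?T, 1)} = 2"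
    by simp
  ultimately show ?thesis
    by (simp only:) (subst card_Un_disjoint, auto simp: card_cartesian_product)
qed

text \<open>The parameter \<open>S\<close> treats both cases of the formula at once. The bound on
  \<open>card S\<close> gives every class of reflections two members to serve as witnesses.\<close>

lemma metric_dimension_gen_dihedral:
  assumes fin: "finite (carrier G)" and S: "subgroup S G" "2 \<le> card S"
    and ST: "S = two_torsion G \<or> two_torsion G = {\<one>} \<and> S = carrier G"
    and a: "a \<in> carrier G - two_torsion G"
  shows "metric_dimension
      (with_proj (commuting_graph (gen_dihedral G) (carrier (gen_dihedral G)))) +
    (2 + card (rcosets S)) = 2 * order G"
proof -
  let ?T = "two_torsion G"
  let ?D = "gen_dihedral G"
  let ?V = "carrier ?D"
  let ?d = "graph_dist (with_proj (commuting_graph ?D ?V))"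
  define com where "com u v \<longleftrightarrow> u \<otimes>\<^bsub>?D\<^esub> v = v \<otimes>\<^bsub>?D\<^esub> u" for u v
  interpret D: group ?D
    by (rule group_gen_dihedral)
  note com_simps = commute_rotations commute_rotation_reflection commute_reflections
  have sub: "S \<subseteq> carrier G"
    using S(1) by (rule subgroup.subset)
  have V: "verts (with_proj (commuting_graph ?D ?V)) = ?V"
    by (simp add: commuting_graph_def)
  have dist: "?d u v = (if u = v then 0 else if com u v then 1 else 2)"
    if "u \<in> ?V" "v \<in> ?V" for u v
    unfolding com_def using D.monoid_axioms that by (rule graph_dist_commuting_graph)
  have V_cases: thesis
    if "u \<in> ?V" "\<And>g. u = (g, 1) \<Longrightarrow> g \<in> carrier G \<Longrightarrow> thesis"
      "\<And>g. u = (g, -1) \<Longrightarrow> g \<in> carrier G \<Longrightarrow> thesis" for u thesis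
    using that by (auto simp: carrier_gen_dihedral)
  have twin: "com u w \<longleftrightarrow> com v w"
    if "u \<in> ?V" "v \<in> ?V" "w \<in> ?V" "twin_class S u = twin_class S v" "w \<noteq> u" "w \<noteq> v" for u v w
    using ST
  proof
    assume "S = ?T"
    with that show ?thesis
      by (elim V_cases) (auto simp: com_def com_simps twin_class_def)
  next
    assume triv: "?T = {\<one>} \<and> S = carrier G"
    \<comment> \<open>Singleton cosets mean that distinct reflections never commute, so all
      reflections are twins.\<close>
    then have "?T #> g = {g}" if "g \<in> carrier G" for g
      using that by (simp add: r_coset_def)
    with that triv show ?thesis
      by (elim V_cases) (auto simp: com_def com_simps twin_class_def)
  qed
  define sep where "sep u v \<longleftrightarrow> (\<exists>w\<in>?V. \<exists>w'\<in>?V. w \<noteq> w' \<and> twin_class S w = twin_class S w' \<and>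
    com u w \<noteq> com v w \<and> com u w' \<noteq> com v w')" for u v
  have sep_sym: "sep u v" if "sep v u" for u v
    using that unfolding sep_def by metis
  have sep_rot_refl: "sep (g, 1) (h, -1)" if "g \<in> carrier G" "h \<in> carrier G" for g h
  proof -
    \<comment> \<open>The rotations by \<open>a\<close> and \<open>inv a\<close> commute with every
      rotation and with no reflection.\<close>
    have "inv a \<in> carrier G - ?T" "a \<noteq> inv a"
      using a by (auto simp: two_torsion_iff)
    then show ?thesis
      unfolding sep_def using a that
      by (intro bexI[of _ "(a, 1)"] bexI[of _ "(inv a, 1)"])
        (auto simp: com_def com_simps twin_class_def carrier_gen_dihedral)
  qed
  have sep_rot: "sep (g, 1) (h, 1)" if "g \<in> carrier G" "h \<in> carrier G"
    "twin_class S (g, 1) \<noteq> twin_class S (h, 1)" for g h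
  proof -
    have "g \<in> ?T \<longleftrightarrow> h \<notin> ?T"
      using that(3) unfolding twin_class_def by (cases "g \<in> ?T"; cases "h \<in> ?T") simp_all
    moreover
    \<comment> \<open>Any reflection separates a 2-torsion rotation from one that is not; two
      elements of \<open>S\<close> give two reflections of the same class.\<close>
    obtain s s' where s: "s \<in> S" "s' \<in> S" "s \<noteq> s'"
      using S(2) by (metis card_2_iff' obtain_subset_with_card_n subset_iff)
    moreover from this have "S #> s = S #> s'" "s \<in> carrier G" "s' \<in> carrier G"
      using S(1) sub by (auto simp: coset_join2[OF subsetD[OF sub]])
    ultimately show ?thesis
      unfolding sep_def using that
      by (intro bexI[of _ "(s, -1)"] bexI[of _ "(s', -1)"])
        (auto simp: com_def com_simps twin_class_def carrier_gen_dihedral)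
  qed
  have sep_refl: "sep (g, -1) (h, -1)"
    if "g \<in> carrier G" "h \<in> carrier G" "twin_class S (g, -1) \<noteq> twin_class S (h, -1)" for g h
  proof -
    have gh: "g \<in> carrier G" "h \<in> carrier G" "S #> g \<noteq> S #> h"
      using that by (auto simp: twin_class_def)
    \<comment> \<open>If \<open>S\<close> were \<open>carrier G\<close>, there would be only one
      coset and hence one class of reflections.\<close>
    have ST: "S = ?T"
      using ST gh S(1) by (metis coset_join2)
    \<comment> \<open>Translating \<open>g\<close> by \<open>s\<close> gives a second reflection in
      its class; both commute with that of \<open>g\<close> but not with that of
      \<open>h\<close>.\<close>
    obtain s where s: "s \<in> S" "s \<noteq> \<one>"
      using S(2) by (metis card_2_iff' obtain_subset_with_card_n subset_iff)
    then have w: "s \<otimes> g \<in> carrier G" "g \<noteq> s \<otimes> g" "S #> g = S #> (s \<otimes> g)"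
      using gh sub S(1) by (auto simp: subset_iff coset_join2 simp flip: coset_mult_assoc)
    have com: "com (g, -1) (k, -1) \<noteq> com (h, -1) (k, -1)" if "k \<in> carrier G" "S #> g = S #> k" for k
      using gh that unfolding ST com_def by (metis commute_reflections)
    show ?thesis
      unfolding sep_def
    proof (intro bexI conjI)
      show "(g, -1::int) \<noteq> (s \<otimes> g, -1)" "(g, -1) \<in> ?V" "(s \<otimes> g, -1) \<in> ?V"
        "twin_class S (g, -1) = twin_class S (s \<otimes> g, -1)"
        using gh w by (simp_all add: carrier_gen_dihedral twin_class_def)
    qed (use com gh w in blast)+
  qed
  have sep: "sep u v" if "u \<in> ?V" "v \<in> ?V" "twin_class S u \<noteq> twin_class S v" for u v
    using that
    by (elim V_cases)
      (auto intro: sep_rot_refl sep_sym[OF sep_rot_refl] sep_rot sep_refl)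
  have "metric_dimension (with_proj (commuting_graph ?D ?V)) + card (twin_class S ` ?V) = card ?V"
  proof (rule metric_dimension_twin_classes[of "with_proj (commuting_graph ?D ?V)" "twin_class S",
        unfolded V])
    show "finite ?V"
      using fin by (simp add: carrier_gen_dihedral)
  next
    fix u v assume "u \<in> ?V" "v \<in> ?V"
    then show "?d u v = 0 \<longleftrightarrow> u = v"
      by (simp add: dist)
  next
    fix u v w assume "u \<in> ?V" "v \<in> ?V" "w \<in> ?V" "twin_class S u = twin_class S v" "w \<noteq> u" "w \<noteq> v"
    then show "?d u w = ?d v w"
      using twin[of u v w] by (simp add: dist)
  next
    fix u v assume uv: "u \<in> ?V" "v \<in> ?V" "twin_class S u \<noteq> twin_class S v"
    \<comment> \<open>Commuting vertices are at distance 0 or 1, all others at distance 2.\<close>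
    have ne: "?d u w \<noteq> ?d v w" if "w \<in> ?V" "com u w \<noteq> com v w" for w
      using that uv by (auto simp: dist com_def)
    show "\<exists>w\<in>?V. \<exists>w'\<in>?V. w \<noteq> w' \<and> twin_class S w = twin_class S w' \<and>
        ?d u w \<noteq> ?d v w \<and> ?d u w' \<noteq> ?d v w'"
      using sep[OF uv] ne unfolding sep_def by blast
  qed
  moreover have "card ?V = 2 * order G"
    by (simp add: carrier_gen_dihedral order_def card_cartesian_product)
  ultimately show ?thesis
    using card_twin_classes[OF fin S(1) a] by simp
qed

end

section \<open>The two cases of the formula\<close>

theorem theorem4p2:
  fixes G :: "('a, 'b) monoid_scheme" and n r :: nat
    and \<Gamma> :: "('a \<times> int) pair_pre_digraph"
  assumes "comm_group G" and "finite (carrier G)" and "order G = n"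
    and "\<not> comm_group (gen_dihedral G)"
    and "2 ^ r = card {g \<in> carrier G. g [^]\<^bsub>G\<^esub> (2::nat) = \<one>\<^bsub>G\<^esub>}"
    and "\<Gamma> = commuting_graph (gen_dihedral G) (carrier (gen_dihedral G))"
  shows "real (metric_dimension (with_proj \<Gamma>)) =
    (if (2::nat) ^ r \<ge> 2 then 2 * real n - real n / 2 ^ r - 2 else 2 * real n - 3)"
proof -
  interpret comm_group G by fact
  let ?T = "two_torsion G"
  have T: "card ?T = 2 ^ r"
    using assms(5) by (simp add: two_torsion_def)
  \<comment> \<open>If every element were its own inverse, the action of -1 would be trivial and
    \<open>gen_dihedral G\<close> abelian.\<close>
  obtain a where a: "a \<in> carrier G - ?T"
  proof (rule ccontr)
    assume "\<not> thesis"
    with that have "carrier G \<subseteq> ?T"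
      by blast
    then have inv: "inv\<^bsub>G\<^esub> g = g" if "g \<in> carrier G" for g
      using that by (metis two_torsion_iff subsetD)
    have "comm_group (gen_dihedral G)"
      by (rule group.group_comm_groupI[OF group_gen_dihedral])
        (auto simp: gen_dihedral_def int_pow_neg inv m_comm)
    with assms(4) show False ..
  qed
  \<comment> \<open>Lagrange's theorem turns the number of cosets into
    \<open>n / card S\<close>.\<close>
  have dim: "real (metric_dimension (with_proj \<Gamma>)) + 2 + real n / real (card S) = 2 * real n"
    if "subgroup S G" "2 \<le> card S" "S = ?T \<or> ?T = {\<one>\<^bsub>G\<^esub>} \<and> S = carrier G" for S
  proof -
    have "card (rcosets\<^bsub>G\<^esub> S) * card S = n"
      using lagrange[OF that(1)] assms(3) by simp
    then have "real n = real (card (rcosets\<^bsub>G\<^esub> S)) * real (card S)"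
      by (metis of_nat_mult)
    then have "real n / real (card S) = real (card (rcosets\<^bsub>G\<^esub> S))"
      using that(2) by simp
    then show ?thesis
      using metric_dimension_gen_dihedral[OF assms(2) that a] assms(3,6)
      by (simp flip: of_nat_add of_nat_mult)
  qed
  show ?thesis
  proof (cases "(2::nat) \<le> 2 ^ r")
    case True
    then have "real (metric_dimension (with_proj \<Gamma>)) + 2 + real n / 2 ^ r = 2 * real n"
      using dim[OF subgroup_two_torsion] T by simp
    with True show ?thesis
      by simp
  next
    case False
    have one: "\<one>\<^bsub>G\<^esub> \<in> ?T"
      by (simp add: two_torsion_iff)
    have "card ?T = 1"
      using T False by (cases r) auto
    then have triv: "?T = {\<one>\<^bsub>G\<^esub>}"
      using one by (metis card_1_singletonE singletonD)
    have "card {\<one>\<^bsub>G\<^esub>, a} \<le> card (carrier G)"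
      by (rule card_mono) (use a assms(2) in auto)
    moreover have "\<one>\<^bsub>G\<^esub> \<noteq> a"
      using a one by blast
    ultimately have two: "2 \<le> card (carrier G)"
      by simp
    \<comment> \<open>Here \<open>S\<close> is all of \<open>G\<close>: one class of reflections and
      two of rotations give the 3 that is subtracted.\<close>
    have "real n / real (card (carrier G)) = 1"
      using two assms(3) by (simp add: order_def)
    then show ?thesis
      using dim[OF subgroup_self two] triv False by simp
  qed
qed

end
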